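(* Let $L$ be a field with a non-archimedean valuation $v:L\to\mathbb{R}\cup\{\infty\}$ such that $v(n\cdot 1_L)=0$ for all $n\in\mathbb{Z}\setminus\{0\}$, let $K$ be its residue field, and let $t\geq 1$ be an integer. Then $$B_1(t,L)\leq t^2\,B_1(t,K)\quad\text{and}\quad B_{\rm m}(t,L)\leq t^2\,B_{\rm m}(t,K).$$
   Context: For a field $F$ and an integer $t\geq 0$, $B_1(t,F)$ (resp. $B_{\rm m}(t,F)$) denotes the supremum, in $\{0,1,2,\dots\}\cup\{\infty\}$, of the number of roots in $F^\ast=F\setminus\{0\}$, counted without (resp. with) multiplicities, that a non-zero polynomial in $F[x]$ with at most $t+1$ monomial terms can have. The residue field of $L$ is $A/\mathfrak{M}$, where $A=\{x\in L: v(x)\geq 0\}$ and $\mathfrak{M}=\{x\in L: v(x)>0\}$. Inequalities are understood in $\mathbb{R}\cup\{\infty\}$. *)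

theory Defs
  imports
    "HOL-Algebra.Polynomial_Divisibility"
    "HOL-Library.Extended_Nat"
    "HOL-Library.Extended_Real"
begin

text \<open>
  Polynomials over a ring \<open>F\<close> are elements of \<^term>\<open>poly_ring F\<close>: coefficient lists
  with the leading coefficient first, the zero polynomial being \<^term>\<open>[]\<close>.
\<close>

definition num_terms :: "('a, 'b) ring_scheme \<Rightarrow> 'a list \<Rightarrow> nat" where
  "num_terms F p = card {i. ring.coeff F p i \<noteq> \<zero>\<^bsub>F\<^esub>}"

definition fewnomials :: "nat \<Rightarrow> ('a, 'b) ring_scheme \<Rightarrow> 'a list set" where
  "fewnomials t F =
    {p \<in> carrier (poly_ring F). p \<noteq> \<zero>\<^bsub>poly_ring F\<^esub> \<and> num_terms F p \<le> t + 1}"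

text \<open>
  Over a field, the cardinality and the multiset size below are those of finite collections,
  because a non-zero polynomial has finitely many roots.
\<close>

definition B_one :: "nat \<Rightarrow> ('a, 'b) ring_scheme \<Rightarrow> enat" where
  "B_one t F =
    (SUP p \<in> fewnomials t F. enat (card {x \<in> carrier F - {\<zero>\<^bsub>F\<^esub>}. ring.is_root F p x}))"

definition B_mult :: "nat \<Rightarrow> ('a, 'b) ring_scheme \<Rightarrow> enat" where
  "B_mult t F =
    (SUP p \<in> fewnomials t F. enat (size {#x \<in># ring.roots F p. x \<noteq> \<zero>\<^bsub>F\<^esub>#}))"

text \<open>
  Valuations are additive, with values in the reals extended by \<open>\<infinity>\<close>; the trivial
  valuation is allowed. Only the values of \<open>v\<close> on \<^term>\<open>carrier L\<close> matter.
\<close>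

locale nonarch_valued_field = field L
  for L :: "('a, 'b) ring_scheme" (structure) +
  fixes v :: "'a \<Rightarrow> ereal"
  assumes val_not_MInf: "x \<in> carrier L \<Longrightarrow> v x \<noteq> -\<infinity>"
    and val_eq_PInf_iff: "x \<in> carrier L \<Longrightarrow> v x = \<infinity> \<longleftrightarrow> x = \<zero>"
    and val_mult: "x \<in> carrier L \<Longrightarrow> y \<in> carrier L \<Longrightarrow> v (x \<otimes> y) = v x + v y"
    and val_add: "x \<in> carrier L \<Longrightarrow> y \<in> carrier L \<Longrightarrow> min (v x) (v y) \<le> v (x \<oplus> y)"

definition valuation_ring :: "('a, 'b) ring_scheme \<Rightarrow> ('a \<Rightarrow> ereal) \<Rightarrow> ('a, 'b) ring_scheme" where
  "valuation_ring L v = L\<lparr>carrier := {x \<in> carrier L. 0 \<le> v x}\<rparr>"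

definition valuation_ideal :: "('a, 'b) ring_scheme \<Rightarrow> ('a \<Rightarrow> ereal) \<Rightarrow> 'a set" where
  "valuation_ideal L v = {x \<in> carrier L. 0 < v x}"

definition residue_field :: "('a, 'b) ring_scheme \<Rightarrow> ('a \<Rightarrow> ereal) \<Rightarrow> 'a set ring" where
  "residue_field L v = valuation_ring L v Quot valuation_ideal L v"

context nonarch_valued_field
begin

lemma val_one: "v \<one> = 0"
proof -
  have "v \<one> = v \<one> + v \<one>" using val_mult[of \<one> \<one>] by simp
  then show ?thesis
    using val_not_MInf[of \<one>] val_eq_PInf_iff[of \<one>] by (cases "v \<one>") auto
qed

lemma val_inverse:
  assumes "x \<in> carrier L" "x \<noteq> \<zero>"
  shows "v (inv x) = - v x"
proof -
  have x: "x \<in> Units L" using assms field_Units by simp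
  then have i: "inv x \<in> carrier L" "inv x \<noteq> \<zero>"
    using Units_inv_Units[of x] field_Units by auto
  have "v x + v (inv x) = 0"
    using val_mult[OF assms(1) i(1)] x val_one by simp
  then show ?thesis
    using val_not_MInf[OF assms(1)] val_eq_PInf_iff[OF assms(1)] assms(2)
      val_not_MInf[OF i(1)] val_eq_PInf_iff[OF i(1)] i(2)
    by (cases "v x"; cases "v (inv x)") auto
qed

lemma val_minus:
  assumes "x \<in> carrier L"
  shows "v (\<ominus> x) = v x"
proof -
  have "v (\<ominus> \<one>) + v (\<ominus> \<one>) = 0"
    using val_mult[of "\<ominus> \<one>" "\<ominus> \<one>"] val_one by (simp add: l_minus)
  then have "v (\<ominus> \<one>) = 0" by (cases "v (\<ominus> \<one>)") auto
  then show ?thesis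
    using val_mult[of "\<ominus> \<one>" x] assms by (simp add: l_minus)
qed

lemma valuation_subring: "subring {x \<in> carrier L. 0 \<le> v x} L"
proof (rule subringI)
  fix h1 h2 assume "h1 \<in> {x \<in> carrier L. 0 \<le> v x}" "h2 \<in> {x \<in> carrier L. 0 \<le> v x}"
  then show "h1 \<oplus> h2 \<in> {x \<in> carrier L. 0 \<le> v x}"
    using val_add[of h1 h2] by (auto simp: min_def split: if_splits)
qed (auto simp: val_one val_minus val_mult)

lemma valuation_ring_domain: "domain (valuation_ring L v)"
  unfolding valuation_ring_def using subring_is_domain[OF valuation_subring] .

lemma valuation_ideal_maximal: "maximalideal (valuation_ideal L v) (valuation_ring L v)"
proof -
  let ?A = "valuation_ring L v" and ?M = "valuation_ideal L v"
  interpret A: domain ?A by (rule valuation_ring_domain)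
  have cA: "carrier ?A = {x \<in> carrier L. 0 \<le> v x}"
    and ops: "\<zero>\<^bsub>?A\<^esub> = \<zero>" "\<one>\<^bsub>?A\<^esub> = \<one>" "add ?A = add L" "mult ?A = mult L"
    by (simp_all add: valuation_ring_def)
  have minus: "\<ominus>\<^bsub>?A\<^esub> a = \<ominus> a" if "a \<in> carrier ?A" for a
  proof (rule A.minus_equality)
    show "\<ominus> a \<oplus>\<^bsub>?A\<^esub> a = \<zero>\<^bsub>?A\<^esub>" using that by (simp add: cA ops l_neg)
  qed (use that in \<open>auto simp: cA val_minus\<close>)
  have ideal: "ideal ?M ?A"
  proof (rule idealI[OF A.ring_axioms])
    show "subgroup ?M (add_monoid ?A)"
    proof (rule group.subgroupI[OF A.add.is_group])
      show "?M \<subseteq> carrier (add_monoid ?A)" by (auto simp: valuation_ideal_def cA)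
      show "?M \<noteq> {}" using val_eq_PInf_iff[of \<zero>] by (auto simp: valuation_ideal_def)
    next
      fix a assume a: "a \<in> ?M"
      then have "\<ominus>\<^bsub>?A\<^esub> a = \<ominus> a" by (auto simp: minus valuation_ideal_def cA)
      then show "inv\<^bsub>add_monoid ?A\<^esub> a \<in> ?M"
        using a val_minus by (simp add: valuation_ideal_def a_inv_def[symmetric])
    next
      fix a b assume "a \<in> ?M" "b \<in> ?M"
      then show "a \<otimes>\<^bsub>add_monoid ?A\<^esub> b \<in> ?M"
        using val_add[of a b]
        by (auto simp: valuation_ideal_def ops min_def split: if_splits)
    qed
  next
    fix a x assume "a \<in> ?M" "x \<in> carrier ?A"
    then show "x \<otimes>\<^bsub>?A\<^esub> a \<in> ?M" "a \<otimes>\<^bsub>?A\<^esub> x \<in> ?M"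
      by (auto simp: valuation_ideal_def cA ops val_mult add_nonneg_pos add_pos_nonneg)
  qed
  show ?thesis
  proof (rule maximalidealI[OF ideal])
    have "\<one> \<in> carrier ?A" "\<one> \<notin> ?M"
      by (auto simp: cA valuation_ideal_def val_one)
    then show "carrier ?A \<noteq> ?M" by blast
  next
    fix J assume J: "ideal J ?A" "?M \<subseteq> J" "J \<subseteq> carrier ?A"
    interpret J: ideal J ?A by (rule J(1))
    show "J = ?M \<or> J = carrier ?A"
    proof (cases "J = ?M")
      case False
      then obtain x where x: "x \<in> J" "x \<notin> ?M" using J(2) by blast
      then have xc: "x \<in> carrier L" "v x = 0"
        using J(3) by (auto simp: cA valuation_ideal_def)
      then have x0: "x \<noteq> \<zero>" using val_eq_PInf_iff[of x] by auto
      then have xu: "x \<in> Units L" using xc field_Units by simp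
      have "inv x \<in> carrier ?A" using xu xc x0 by (simp add: cA val_inverse)
      then have "inv x \<otimes>\<^bsub>?A\<^esub> x \<in> J" using J.I_l_closed x(1) by blast
      then have "\<one>\<^bsub>?A\<^esub> \<in> J" using xu by (simp add: ops)
      then show ?thesis using J.one_imp_carrier by blast
    qed simp
  qed
qed

lemma residue_field_is_field: "field (residue_field L v)"
  unfolding residue_field_def
  using maximalideal.quotient_is_field[OF valuation_ideal_maximal]
    domain.axioms(1)[OF valuation_ring_domain] by blast

end

end

theory Submission
  imports Defs
begin

text \<open>
  Let \<open>f = \<Sum> a\<^sub>i x\<^sup>i\<close> have at most \<open>t + 1\<close> terms over \<open>L\<close>, and let \<open>\<kappa>\<close> be the residue field.
  The bounds rest on three facts.

  First, the non-zero roots of \<open>f\<close> have at most \<open>t\<close> different valuations. At a root \<open>s\<close> the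
  minimum of \<open>v a\<^sub>i + i v s\<close> is attained for at least two exponents \<open>i\<close>, which belong to an edge
  of the Newton polygon; the left end of the edge determines its slope and is never the largest
  exponent of \<open>f\<close> (\<open>card_root_valuations_less_num_terms\<close>).

  Second, fix the valuation \<open>v s\<close> of a root. After the substitution of \<open>s x\<close> for \<open>x\<close> and a
  multiplication by a constant, \<open>f\<close> has a non-zero reduction over \<open>\<kappa>\<close>, again with at most
  \<open>t + 1\<close> terms. Each linear factor of \<open>f\<close> that belongs to a root of valuation \<open>v s\<close> becomes a
  linear factor of the reduction that belongs to a non-zero root, so the reduction has at least as
  many non-zero roots, with multiplicities, as \<open>f\<close> has roots of valuation \<open>v s\<close>
  (\<open>size_roots_val_le_size_roots_reduction\<close>). With the first fact, the bound with multiplicities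
  for \<open>L\<close> is at most \<open>t\<close> times that for \<open>\<kappa>\<close> (\<open>B_mult_le_B_mult_residue_field\<close>).

  Third, the hypothesis on the valuation of the integers says that \<open>\<kappa>\<close> has characteristic zero,
  and there a non-zero root of a polynomial with at most \<open>t + 1\<close> terms has multiplicity at most
  \<open>t\<close>, because a suitable first-order differential operator removes one term and lowers the
  multiplicity by at most one (\<open>linear_pow_divisor_less_num_terms\<close>). So over \<open>\<kappa>\<close> the bound with
  multiplicities is at most \<open>t\<close> times the bound without (\<open>B_mult_le_B_one\<close>).

  Multiplicities only increase the count, so the bound without multiplicities for \<open>L\<close> is at most
  \<open>t \<cdot> t\<close> times that for \<open>\<kappa>\<close>; and \<open>t \<le> t\<^sup>2\<close> gives the bound with multiplicities.
\<close>

section \<open>Polynomials as coefficient sequences\<close>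

definition (in ring) poly_of_coeffs :: "nat \<Rightarrow> (nat \<Rightarrow> 'a) \<Rightarrow> 'a list" where
  "poly_of_coeffs n c = normalize (map c (rev [0..<n]))"

context ring
begin

lemma coeff_poly_of_coeffs:
  assumes "\<And>i. n \<le> i \<Longrightarrow> c i = \<zero>"
  shows "coeff (poly_of_coeffs n c) = c"
proof -
  let ?l = "map c (rev [0..<n])"
  have "coeff ?l i = c i" for i
  proof (cases "i < n")
    case True
    then show ?thesis by (simp add: coeff_nth rev_nth)
  next
    case False
    then show ?thesis using assms coeff_length[of ?l i] by simp
  qed
  then show ?thesis
    by (simp add: poly_of_coeffs_def normalize_coeff[symmetric] fun_eq_iff)
qed

lemma poly_of_coeffs_closed:
  assumes "\<And>i. c i \<in> carrier R"
  shows "poly_of_coeffs n c \<in> carrier (poly_ring R)"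
  unfolding univ_poly_carrier[symmetric] poly_of_coeffs_def
  by (rule normalize_gives_polynomial) (use assms in auto)

lemma poly_eqI:
  assumes "p \<in> carrier (poly_ring R)" "q \<in> carrier (poly_ring R)" "\<And>i. coeff p i = coeff q i"
  shows "p = q"
  using assms coeff_iff_polynomial_cond[of "carrier R" p q]
  by (auto simp: univ_poly_carrier fun_eq_iff)

lemma poly_coeff_closed:
  assumes "p \<in> carrier (poly_ring R)" shows "coeff p i \<in> carrier R"
  using assms by (simp add: univ_poly_carrier[symmetric] polynomial_incl)

lemma poly_nonzero_iff:
  assumes "p \<in> carrier (poly_ring R)"
  shows "p \<noteq> [] \<longleftrightarrow> (\<exists>i. coeff p i \<noteq> \<zero>)"
  using poly_eqI[OF assms univ_poly_zero_closed] by auto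

lemma finite_coeff_support: "finite {i. coeff p i \<noteq> \<zero>}"
  by (rule finite_subset[of _ "{..<length p}"]) (auto simp: coeff_length not_le intro: ccontr)

lemma linear_poly_closed:
  assumes "a \<in> carrier R" "\<one> \<noteq> \<zero>"
  shows "[\<one>, \<ominus> a] \<in> carrier (poly_ring R)"
  using assms by (simp add: univ_poly_carrier[symmetric] polynomial_def)

lemma coeff_linear_mult:
  assumes a: "a \<in> carrier R" and q: "q \<in> carrier (poly_ring R)"
  shows "coeff ([\<one>, \<ominus> a] \<otimes>\<^bsub>poly_ring R\<^esub> q) i =
    (case i of 0 \<Rightarrow> \<zero> | Suc j \<Rightarrow> coeff q j) \<ominus> a \<otimes> coeff q i"
proof -
  have qs: "set q \<subseteq> carrier R" using q by (simp add: univ_poly_carrier[symmetric] polynomial_incl)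
  have c [simp]: "coeff q j \<in> carrier R" for j using poly_coeff_closed[OF q] .
  have id: "map ((\<otimes>) \<one>) q = q" using qs by (induction q) auto
  have shift: "coeff (q @ [\<zero>]) i = (case i of 0 \<Rightarrow> \<zero> | Suc j \<Rightarrow> coeff q j)"
    by (induction q) (auto split: nat.splits)
  have m: "set (map ((\<otimes>) (\<ominus> a)) q) \<subseteq> carrier R" using a qs by auto
  have t: "coeff (poly_mult [\<ominus> a] q) = (\<lambda>i. \<ominus> a \<otimes> coeff q i)"
    using a m qs by (simp del: poly_add.simps add: poly_add_coeff scalar_coeff)
  have ts: "set (poly_mult [\<ominus> a] q) \<subseteq> carrier R"
    by (rule poly_mult_in_carrier) (use a qs in auto)
  have "coeff (poly_mult [\<one>, \<ominus> a] q) i = coeff (q @ [\<zero>]) i \<oplus> coeff (poly_mult [\<ominus> a] q) i"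
    using poly_add_coeff[of "q @ [\<zero>]" "poly_mult [\<ominus> a] q"] ts qs
    by (simp del: poly_add.simps add: id)
  then show ?thesis
    using a by (simp del: poly_mult.simps poly_add.simps add: univ_poly_mult shift t a_minus_def l_minus)
qed

end

section \<open>Multiplicities in characteristic zero\<close>

text \<open>
  The operator \<open>x d/dx - e\<close>. It multiplies the coefficient of \<open>x\<^sup>i\<close> by \<open>i - e\<close>, so in
  characteristic zero it removes the term of exponent \<open>e\<close> and keeps all others.
\<close>

definition (in ring) euler_deriv :: "nat \<Rightarrow> 'a list \<Rightarrow> 'a list" where
  "euler_deriv e p = poly_of_coeffs (length p) (\<lambda>i. ([i] \<cdot> \<one> \<ominus> [e] \<cdot> \<one>) \<otimes> coeff p i)"

context domain
begin

lemma euler_deriv_closed: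
  assumes "p \<in> carrier (poly_ring R)"
  shows "euler_deriv e p \<in> carrier (poly_ring R)"
  unfolding euler_deriv_def
  by (rule poly_of_coeffs_closed) (use poly_coeff_closed[OF assms] in auto)

lemma coeff_euler_deriv:
  "coeff (euler_deriv e p) i = ([i] \<cdot> \<one> \<ominus> [e] \<cdot> \<one>) \<otimes> coeff p i"
  unfolding euler_deriv_def
  by (subst coeff_poly_of_coeffs) (auto simp: coeff_length)

text \<open>
  The Leibniz rule for the factor \<open>x - a\<close>, as \<open>x d/dx (x - a) = x\<close>.
\<close>

lemma euler_deriv_linear_mult:
  assumes a: "a \<in> carrier R" and q: "q \<in> carrier (poly_ring R)"
  shows "euler_deriv e ([\<one>, \<ominus> a] \<otimes>\<^bsub>poly_ring R\<^esub> q) =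
    [\<one>, \<ominus> a] \<otimes>\<^bsub>poly_ring R\<^esub> euler_deriv e q \<oplus>\<^bsub>poly_ring R\<^esub> X \<otimes>\<^bsub>poly_ring R\<^esub> q"
    (is "?l = ?r")
proof -
  interpret P: domain "poly_ring R" by (rule univ_poly_is_domain[OF carrier_is_subring])
  have l: "[\<one>, \<ominus> a] \<in> carrier (poly_ring R)" using a by (rule linear_poly_closed) simp
  have D: "euler_deriv e q \<in> carrier (poly_ring R)" by (rule euler_deriv_closed[OF q])
  have X: "X \<in> carrier (poly_ring R)" using var_closed(1)[OF carrier_is_subring] .
  \<comment> \<open>With \<open>x\<close> as \<open>x - 0\<close> both products on the right are multiples of a linear factor.\<close>
  have X': "X = [\<one>, \<ominus> \<zero>]" by (simp add: var_def)
  have [simp]: "coeff q i \<in> carrier R" for i using poly_coeff_closed[OF q] .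
  have sum: "coeff (s \<oplus>\<^bsub>poly_ring R\<^esub> s') i = coeff s i \<oplus> coeff s' i"
    if "s \<in> carrier (poly_ring R)" "s' \<in> carrier (poly_ring R)" for s s' i
    using that poly_add_coeff[of s s']
    by (simp add: univ_poly_add univ_poly_carrier[symmetric] polynomial_incl)
  show ?thesis
  proof (rule poly_eqI)
    show "?l \<in> carrier (poly_ring R)" using l q by (simp add: euler_deriv_closed)
    show "?r \<in> carrier (poly_ring R)" using l q D X by simp
    fix i
    have id: "(k \<oplus> \<one> \<ominus> E) \<otimes> (b \<ominus> a \<otimes> c) =
        ((k \<ominus> E) \<otimes> b \<ominus> a \<otimes> ((k \<oplus> \<one> \<ominus> E) \<otimes> c)) \<oplus> (b \<ominus> \<zero> \<otimes> c)"
      if "k \<in> carrier R" "E \<in> carrier R" "b \<in> carrier R" "c \<in> carrier R" for k E b c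
      using a that by algebra
    have id_0: "E \<otimes> (\<zero> \<ominus> a \<otimes> c) = (\<zero> \<ominus> a \<otimes> (E \<otimes> c)) \<oplus> (\<zero> \<ominus> \<zero> \<otimes> c)"
      if "E \<in> carrier R" "c \<in> carrier R" for E c
      using a that by algebra
    have "coeff ?l i = ([i] \<cdot> \<one> \<ominus> [e] \<cdot> \<one>) \<otimes>
        ((case i of 0 \<Rightarrow> \<zero> | Suc j \<Rightarrow> coeff q j) \<ominus> a \<otimes> coeff q i)"
      by (simp only: coeff_euler_deriv coeff_linear_mult[OF a q])
    also have "\<dots> = ((case i of 0 \<Rightarrow> \<zero> | Suc j \<Rightarrow> coeff (euler_deriv e q) j)
          \<ominus> a \<otimes> coeff (euler_deriv e q) i)
        \<oplus> ((case i of 0 \<Rightarrow> \<zero> | Suc j \<Rightarrow> coeff q j) \<ominus> \<zero> \<otimes> coeff q i)"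
    proof (cases i)
      case 0
      show ?thesis unfolding 0 nat.case coeff_euler_deriv by (rule id_0) simp_all
    next
      case (Suc j)
      show ?thesis unfolding Suc nat.case coeff_euler_deriv add.nat_pow_Suc by (rule id) simp_all
    qed
    also have "\<dots> = coeff ?r i"
      using l q D X by (simp only: sum P.m_closed coeff_linear_mult[OF a D]
        X' coeff_linear_mult[OF zero_closed q])
    finally show "coeff ?l i = coeff ?r i" .
  qed
qed

text \<open>
  A first-order operator lowers the order of vanishing at \<open>a\<close> by at most one: when a further
  factor \<open>x - a\<close> is split off, both summands of the Leibniz rule keep \<open>n\<close> such factors.
\<close>

lemma euler_deriv_linear_pow_mult:
  assumes a: "a \<in> carrier R" and g: "g \<in> carrier (poly_ring R)"
  obtains h where "h \<in> carrier (poly_ring R)"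
    "euler_deriv e ([\<one>, \<ominus> a] [^]\<^bsub>poly_ring R\<^esub> Suc n \<otimes>\<^bsub>poly_ring R\<^esub> g) =
      [\<one>, \<ominus> a] [^]\<^bsub>poly_ring R\<^esub> n \<otimes>\<^bsub>poly_ring R\<^esub> h"
proof -
  interpret P: domain "poly_ring R" by (rule univ_poly_is_domain[OF carrier_is_subring])
  let ?P = "[\<one>, \<ominus> a]"
  have l: "?P \<in> carrier (poly_ring R)" using a by (rule linear_poly_closed) simp
  have X: "X \<in> carrier (poly_ring R)" using var_closed(1)[OF carrier_is_subring] .
  have "\<exists>h \<in> carrier (poly_ring R). euler_deriv e (?P [^]\<^bsub>poly_ring R\<^esub> Suc n \<otimes>\<^bsub>poly_ring R\<^esub> g) =
      ?P [^]\<^bsub>poly_ring R\<^esub> n \<otimes>\<^bsub>poly_ring R\<^esub> h"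
  proof (induction n)
    case 0
    show ?case
      using l g by (intro bexI[of _ "euler_deriv e (?P \<otimes>\<^bsub>poly_ring R\<^esub> g)"]) (simp_all add: euler_deriv_closed)
  next
    case (Suc n)
    let ?Q = "?P [^]\<^bsub>poly_ring R\<^esub> n"
    from Suc obtain h where h: "h \<in> carrier (poly_ring R)"
      "euler_deriv e (?P [^]\<^bsub>poly_ring R\<^esub> Suc n \<otimes>\<^bsub>poly_ring R\<^esub> g) = ?Q \<otimes>\<^bsub>poly_ring R\<^esub> h" by blast
    have Q: "?Q \<in> carrier (poly_ring R)" using l by simp
    have "?P [^]\<^bsub>poly_ring R\<^esub> Suc (Suc n) \<otimes>\<^bsub>poly_ring R\<^esub> g =
        ?P \<otimes>\<^bsub>poly_ring R\<^esub> (?P [^]\<^bsub>poly_ring R\<^esub> Suc n \<otimes>\<^bsub>poly_ring R\<^esub> g)"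
      using l g Q by (simp add: P.m_ac)
    then have "euler_deriv e (?P [^]\<^bsub>poly_ring R\<^esub> Suc (Suc n) \<otimes>\<^bsub>poly_ring R\<^esub> g) =
        ?P \<otimes>\<^bsub>poly_ring R\<^esub> (?Q \<otimes>\<^bsub>poly_ring R\<^esub> h) \<oplus>\<^bsub>poly_ring R\<^esub>
        X \<otimes>\<^bsub>poly_ring R\<^esub> (?P [^]\<^bsub>poly_ring R\<^esub> Suc n \<otimes>\<^bsub>poly_ring R\<^esub> g)"
      using euler_deriv_linear_mult[OF a, of "?P [^]\<^bsub>poly_ring R\<^esub> Suc n \<otimes>\<^bsub>poly_ring R\<^esub> g"] l g h by simp
    also have "\<dots> = ?P [^]\<^bsub>poly_ring R\<^esub> Suc n \<otimes>\<^bsub>poly_ring R\<^esub> (h \<oplus>\<^bsub>poly_ring R\<^esub> X \<otimes>\<^bsub>poly_ring R\<^esub> g)"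
      using l g h(1) Q X by (simp add: P.r_distr P.m_ac)
    finally show ?case using h(1) X g by blast
  qed
  then show thesis using that by blast
qed

text \<open>
  Injectivity of \<open>n \<mapsto> n \<cdot> 1\<close> expresses characteristic zero. By induction on the order of
  vanishing: for an exponent \<open>e\<close> that occurs in \<open>p\<close>, the operator \<open>x d/dx - e\<close> turns \<open>p\<close> into a
  polynomial with one term less, which still vanishes to order \<open>n\<close> at \<open>a\<close> if \<open>p\<close> vanishes to order
  \<open>n + 1\<close>.
\<close>

theorem linear_pow_divisor_less_num_terms:
  assumes char_0: "inj (\<lambda>n :: nat. [n] \<cdot> \<one>)"
    and a: "a \<in> carrier R" "a \<noteq> \<zero>"
    and "p \<in> carrier (poly_ring R)" "p \<noteq> []"
    and "[\<one>, \<ominus> a] [^]\<^bsub>poly_ring R\<^esub> n pdivides p"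
  shows "n < num_terms R p"
  using assms(4-)
proof (induction n arbitrary: p)
  case 0
  then show ?case
    using poly_nonzero_iff[of p] finite_coeff_support[of p] by (auto simp: num_terms_def card_gt_0_iff)
next
  case (Suc n)
  interpret P: domain "poly_ring R" by (rule univ_poly_is_domain[OF carrier_is_subring])
  have l: "[\<one>, \<ominus> a] \<in> carrier (poly_ring R)" using a(1) by (rule linear_poly_closed) simp
  have [simp]: "coeff p i \<in> carrier R" for i using poly_coeff_closed[OF Suc.prems(1)] .
  obtain e where e: "coeff p e \<noteq> \<zero>" using poly_nonzero_iff Suc.prems(1,2) by blast
  from Suc.prems(3) obtain g where g: "g \<in> carrier (poly_ring R)"
      "p = [\<one>, \<ominus> a] [^]\<^bsub>poly_ring R\<^esub> Suc n \<otimes>\<^bsub>poly_ring R\<^esub> g"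
    by (auto simp: pdivides_def factor_def)
  let ?p' = "euler_deriv e p"
  have p': "?p' \<in> carrier (poly_ring R)" by (rule euler_deriv_closed[OF Suc.prems(1)])
  have dvd: "[\<one>, \<ominus> a] [^]\<^bsub>poly_ring R\<^esub> n pdivides ?p'"
    using euler_deriv_linear_pow_mult[OF a(1) g(1), of e n] unfolding g(2)[symmetric] pdivides_def factor_def
    by blast
  have "[i] \<cdot> \<one> \<ominus> [e] \<cdot> \<one> = \<zero> \<longleftrightarrow> i = e" for i :: nat
    using char_0 by (auto simp: r_right_minus_eq inj_def)
  then have supp: "{i. coeff ?p' i \<noteq> \<zero>} = {i. coeff p i \<noteq> \<zero>} - {e}"
    by (auto simp: coeff_euler_deriv integral_iff)
  have card: "num_terms R p = Suc (num_terms R ?p')"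
    unfolding num_terms_def supp using e finite_coeff_support[of p] by (intro card.remove) auto
  show ?case
  proof (cases "?p' = []")
    case False
    then show ?thesis using Suc.IH[OF p' False dvd] card by simp
  next
    case True
    \<comment> \<open>Only the term of exponent \<open>e\<close> is left, and a monomial does not vanish at \<open>a \<noteq> \<zero>\<close>.\<close>
    then have z: "coeff p i = \<zero>" if "i \<noteq> e" for i
      using supp that by auto
    have m: "monom (coeff p e) e \<in> carrier (poly_ring R)"
      using e by (simp add: univ_poly_carrier[symmetric] monom_is_polynomial[OF carrier_is_subring])
    have p: "p = monom (coeff p e) e"
      by (rule poly_eqI[OF Suc.prems(1) m]) (auto simp: monom_coeff z)
    have "[\<one>, \<ominus> a] pdivides p"
      unfolding pdivides_def factor_def
      using l g(1) by (intro bexI[of _ "[\<one>, \<ominus> a] [^]\<^bsub>poly_ring R\<^esub> n \<otimes>\<^bsub>poly_ring R\<^esub> g"]) (simp_all add: g(2) P.m_ac)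
    then have "eval p a = \<zero>"
      using pdivides_imp_is_root[OF Suc.prems(2) a(1)] by (simp add: is_root_def)
    moreover have "eval p a = coeff p e \<otimes> a [^] e"
      by (subst p, subst eval_monom) (use a e in auto)
    moreover have "a [^] m \<noteq> \<zero>" for m :: nat
      using a by (induction m) (auto simp: integral_iff)
    ultimately show ?thesis using a(1) e by (auto simp: integral_iff)
  qed
qed

corollary alg_mult_less_num_terms:
  assumes "inj (\<lambda>n :: nat. [n] \<cdot> \<one>)" "a \<in> carrier R" "a \<noteq> \<zero>"
    and "p \<in> carrier (poly_ring R)" "p \<noteq> []"
  shows "alg_mult p a < num_terms R p"
  using linear_pow_divisor_less_num_terms[OF assms] alg_multE(1)[OF assms(2,4,5)] by blast

end

section \<open>Reduction of a rescaled polynomial\<close>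

definition (in nonarch_valued_field) residue :: "'a \<Rightarrow> 'a set" where
  "residue x = valuation_ideal L v +>\<^bsub>valuation_ring L v\<^esub> x"

context nonarch_valued_field
begin

abbreviation "\<kappa> \<equiv> residue_field L v"

lemma residue_ring_hom: "ring_hom_ring (valuation_ring L v) \<kappa> residue"
proof -
  have "ideal (valuation_ideal L v) (valuation_ring L v)"
    using valuation_ideal_maximal by (rule maximalideal.axioms(1))
  then show ?thesis
    unfolding residue_field_def residue_def[abs_def] by (rule ideal.rcos_ring_hom_ring)
qed

lemma
  assumes "x \<in> carrier L" "0 \<le> v x"
  shows residue_closed: "residue x \<in> carrier \<kappa>"
    and residue_eq_zero_iff: "residue x = \<zero>\<^bsub>\<kappa>\<^esub> \<longleftrightarrow> 0 < v x"
proof -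
  interpret h: ring_hom_ring "valuation_ring L v" \<kappa> residue by (rule residue_ring_hom)
  interpret I: maximalideal "valuation_ideal L v" "valuation_ring L v" by (rule valuation_ideal_maximal)
  have x: "x \<in> carrier (valuation_ring L v)" using assms by (simp add: valuation_ring_def)
  then show "residue x \<in> carrier \<kappa>" by simp
  have "residue x = residue \<zero>\<^bsub>valuation_ring L v\<^esub> \<longleftrightarrow> x \<in> valuation_ideal L v"
    using h.R.quotient_eq_iff_same_a_r_cos[OF I.is_ideal x h.R.zero_closed] x
    by (simp add: residue_def a_minus_def)
  then show "residue x = \<zero>\<^bsub>\<kappa>\<^esub> \<longleftrightarrow> 0 < v x"
    using assms by (simp add: valuation_ideal_def)
qed

lemma residue_one: "residue \<one> = \<one>\<^bsub>\<kappa>\<^esub>"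
  using ring_hom_ring.homh[OF residue_ring_hom, THEN ring_hom_one] by (simp add: valuation_ring_def)

lemma residue_zero: "residue \<zero> = \<zero>\<^bsub>\<kappa>\<^esub>"
  using residue_eq_zero_iff[of \<zero>] val_eq_PInf_iff[of \<zero>] by simp

lemma
  assumes "x \<in> carrier L" "0 \<le> v x" "y \<in> carrier L" "0 \<le> v y"
  shows residue_mult: "residue (x \<otimes> y) = residue x \<otimes>\<^bsub>\<kappa>\<^esub> residue y"
    and residue_add: "residue (x \<oplus> y) = residue x \<oplus>\<^bsub>\<kappa>\<^esub> residue y"
  using ring_hom_mult[OF ring_hom_ring.homh[OF residue_ring_hom], of x y]
    ring_hom_add[OF ring_hom_ring.homh[OF residue_ring_hom], of x y] assms
  by (simp_all add: valuation_ring_def)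

lemma residue_minus:
  assumes "x \<in> carrier L" "0 \<le> v x" "y \<in> carrier L" "0 \<le> v y"
  shows "residue (x \<ominus> y) = residue x \<ominus>\<^bsub>\<kappa>\<^esub> residue y"
proof -
  interpret K: field \<kappa> by (rule residue_field_is_field)
  have c: "residue x \<in> carrier \<kappa>" "residue y \<in> carrier \<kappa>" "residue (\<ominus> y) \<in> carrier \<kappa>"
    using assms by (simp_all add: residue_closed val_minus)
  have "residue (\<ominus> y) \<oplus>\<^bsub>\<kappa>\<^esub> residue y = \<zero>\<^bsub>\<kappa>\<^esub>"
    using assms by (simp add: residue_add[symmetric] val_minus l_neg residue_zero)
  then have "residue (\<ominus> y) = \<ominus>\<^bsub>\<kappa>\<^esub> residue y" using c K.minus_equality by simp
  then show ?thesis using assms by (simp add: a_minus_def residue_add val_minus K.minus_eq)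
qed

lemma val_diff_nonneg:
  assumes "x \<in> carrier L" "0 \<le> v x" "y \<in> carrier L" "0 \<le> v y"
  shows "0 \<le> v (x \<ominus> y)"
  using val_add[of x "\<ominus> y"] assms by (auto simp: a_minus_def val_minus min_def split: if_splits)

lemma val_zero: "v \<zero> = \<infinity>"
  using val_eq_PInf_iff[of \<zero>] by simp

text \<open>
  A non-zero integer has valuation \<open>0\<close>, so it is a unit of the valuation ring and its residue is
  non-zero: the residue field has characteristic zero.
\<close>

lemma inj_residue_nat:
  assumes "\<And>n :: int. n \<noteq> 0 \<Longrightarrow> v ([n] \<cdot> \<one>) = 0"
  shows "inj (\<lambda>n :: nat. [n] \<cdot>\<^bsub>\<kappa>\<^esub> \<one>\<^bsub>\<kappa>\<^esub>)"
proof -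
  interpret K: field \<kappa> by (rule residue_field_is_field)
  have v: "v ([n] \<cdot> \<one>) = 0" if "n \<noteq> 0" for n :: nat
    using assms[of "int n"] that by (simp add: add_pow_int_ge)
  then have v0: "0 \<le> v ([n] \<cdot> \<one>)" for n :: nat by (cases "n = 0") (simp_all add: val_zero)
  have hom: "residue ([n] \<cdot> \<one>) = [n] \<cdot>\<^bsub>\<kappa>\<^esub> \<one>\<^bsub>\<kappa>\<^esub>" for n :: nat
    by (induction n) (simp_all add: residue_zero residue_one residue_add v0 val_one)
  have nz: "[n] \<cdot>\<^bsub>\<kappa>\<^esub> \<one>\<^bsub>\<kappa>\<^esub> \<noteq> \<zero>\<^bsub>\<kappa>\<^esub>" if "n \<noteq> 0" for n :: nat
    using residue_eq_zero_iff[of "[n] \<cdot> \<one>"] v[OF that] by (simp add: hom)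
  have *: "m = n" if eq: "[m] \<cdot>\<^bsub>\<kappa>\<^esub> \<one>\<^bsub>\<kappa>\<^esub> = [n] \<cdot>\<^bsub>\<kappa>\<^esub> \<one>\<^bsub>\<kappa>\<^esub>" and le: "m \<le> n" for m n :: nat
  proof -
    have "[n] \<cdot>\<^bsub>\<kappa>\<^esub> \<one>\<^bsub>\<kappa>\<^esub> = ([m] \<cdot>\<^bsub>\<kappa>\<^esub> \<one>\<^bsub>\<kappa>\<^esub>) \<oplus>\<^bsub>\<kappa>\<^esub> ([(n - m)] \<cdot>\<^bsub>\<kappa>\<^esub> \<one>\<^bsub>\<kappa>\<^esub>)"
      using le by (simp add: K.add.nat_pow_mult)
    then have "[(n - m)] \<cdot>\<^bsub>\<kappa>\<^esub> \<one>\<^bsub>\<kappa>\<^esub> = \<zero>\<^bsub>\<kappa>\<^esub>"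
      unfolding eq[symmetric] by (subst (asm) eq_commute, subst (asm) K.add.l_cancel_one) simp_all
    then show ?thesis using nz[of "n - m"] le by (cases "n - m = 0") auto
  qed
  show ?thesis
  proof (rule injI)
    fix m n :: nat assume "[m] \<cdot>\<^bsub>\<kappa>\<^esub> \<one>\<^bsub>\<kappa>\<^esub> = [n] \<cdot>\<^bsub>\<kappa>\<^esub> \<one>\<^bsub>\<kappa>\<^esub>"
    then show "m = n" using *[of m n] *[of n m] by (cases "m \<le> n") simp_all
  qed
qed

end

text \<open>
  The next two definitions concern the polynomial \<open>c f(s x)\<close>: that it has coefficients in the
  valuation ring, and its reduction to the residue field. To keep the scaling by \<open>s\<close> as a
  parameter makes it possible to work with the roots of \<open>f\<close> itself instead of those of
  \<open>c f(s x)\<close>.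
\<close>

definition (in nonarch_valued_field) scaled_integral :: "'a \<Rightarrow> 'a \<Rightarrow> 'a list \<Rightarrow> bool" where
  "scaled_integral c s f \<longleftrightarrow> (\<forall>i. 0 \<le> v (c \<otimes> coeff f i \<otimes> s [^] i))"

definition (in nonarch_valued_field) scaled_reduction :: "'a \<Rightarrow> 'a \<Rightarrow> 'a list \<Rightarrow> 'a set list" where
  "scaled_reduction c s f =
    ring.poly_of_coeffs \<kappa> (length f) (\<lambda>i. residue (c \<otimes> coeff f i \<otimes> s [^] i))"

context nonarch_valued_field
begin

lemma coeff_scaled_reduction:
  assumes "c \<in> carrier L" "s \<in> carrier L"
  shows "ring.coeff \<kappa> (scaled_reduction c s f) i = residue (c \<otimes> coeff f i \<otimes> s [^] i)"
proof -
  interpret K: field \<kappa> by (rule residue_field_is_field)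
  show ?thesis unfolding scaled_reduction_def
    by (subst K.coeff_poly_of_coeffs) (use assms in \<open>auto simp: coeff_length residue_zero\<close>)
qed

lemma scaled_reduction_closed:
  assumes "c \<in> carrier L" "s \<in> carrier L" "f \<in> carrier (poly_ring L)" "scaled_integral c s f"
  shows "scaled_reduction c s f \<in> carrier (poly_ring \<kappa>)"
proof -
  interpret K: field \<kappa> by (rule residue_field_is_field)
  show ?thesis unfolding scaled_reduction_def
    by (rule K.poly_of_coeffs_closed, rule residue_closed)
      (use assms poly_coeff_closed[OF assms(3)] in \<open>auto simp: scaled_integral_def\<close>)
qed

text \<open>
  Since \<open>s x - r = s (x - r / s)\<close>, the factor \<open>x - r\<close> of \<open>f\<close> becomes \<open>x - u\<close> with the unit
  \<open>u = r / s\<close>, and the constant \<open>s\<close> passes to the cofactor, which is why its scaling is by \<open>c s\<close>.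
  Synthetic division by \<open>x - u\<close> stays in the valuation ring, because \<open>u\<close> is a unit.
\<close>

lemma scaled_reduction_linear_mult:
  assumes c: "c \<in> carrier L" and s: "s \<in> carrier L" "s \<noteq> \<zero>"
    and r: "r \<in> carrier L" "v r = v s" and q: "q \<in> carrier (poly_ring L)"
    and int: "scaled_integral c s ([\<one>, \<ominus> r] \<otimes>\<^bsub>poly_ring L\<^esub> q)"
  defines "u \<equiv> r \<otimes> inv s"
  shows "scaled_integral (c \<otimes> s) s q"
    and "scaled_reduction c s ([\<one>, \<ominus> r] \<otimes>\<^bsub>poly_ring L\<^esub> q) =
      [\<one>\<^bsub>\<kappa>\<^esub>, \<ominus>\<^bsub>\<kappa>\<^esub> residue u] \<otimes>\<^bsub>poly_ring \<kappa>\<^esub> scaled_reduction (c \<otimes> s) s q" (is "?lhs = ?rhs")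
proof -
  interpret P: domain "poly_ring L" by (rule univ_poly_is_domain[OF carrier_is_subring])
  interpret K: field \<kappa> by (rule residue_field_is_field)
  interpret PK: domain "poly_ring \<kappa>" by (rule K.univ_poly_is_domain[OF K.carrier_is_subring])
  let ?f = "[\<one>, \<ominus> r] \<otimes>\<^bsub>poly_ring L\<^esub> q"
  have l: "[\<one>, \<ominus> r] \<in> carrier (poly_ring L)" using r(1) by (rule linear_poly_closed) simp
  have f: "?f \<in> carrier (poly_ring L)" using l q by simp
  have [simp]: "coeff q i \<in> carrier L" "coeff ?f i \<in> carrier L" for i
    using poly_coeff_closed q f by auto
  have sU: "s \<in> Units L" using s field_Units by simp
  have u: "u \<in> carrier L" "u \<noteq> \<zero>" "v u = 0"
  proof -
    have s': "inv s \<in> carrier L" "inv s \<noteq> \<zero>" using sU Units_inv_Units[of s] field_Units by auto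
    have vs: "v s \<noteq> \<infinity>" "v s \<noteq> -\<infinity>" using s val_eq_PInf_iff val_not_MInf by auto
    then have r0: "r \<noteq> \<zero>" using r(2) val_zero by auto
    show "u \<in> carrier L" "u \<noteq> \<zero>" using r(1) r0 s' by (auto simp: u_def integral_iff)
    show "v u = 0" using vs r s' s by (cases "v s") (auto simp: u_def val_mult val_inverse)
  qed
  have us: "u \<otimes> s = r" using r s sU by (simp add: u_def m_assoc Units_l_inv)
  define a where "a i = c \<otimes> coeff ?f i \<otimes> s [^] i" for i
  define b where "b i = c \<otimes> s \<otimes> coeff q i \<otimes> s [^] i" for i
  define b' where "b' i = (case i of 0 \<Rightarrow> \<zero> | Suc j \<Rightarrow> b j)" for i
  have [simp]: "a i \<in> carrier L" "b i \<in> carrier L" "b' i \<in> carrier L" for i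
    using c s by (auto simp: a_def b_def b'_def split: nat.split)
  have ab: "a i = b' i \<ominus> u \<otimes> b i" for i
  proof -
    have id: "c \<otimes> (x \<ominus> u \<otimes> s \<otimes> y) \<otimes> w = c \<otimes> x \<otimes> w \<ominus> u \<otimes> (c \<otimes> s \<otimes> y \<otimes> w)"
      if "x \<in> carrier L" "y \<in> carrier L" "w \<in> carrier L" for x y w
      using c s u that by algebra
    have "a i = c \<otimes> ((case i of 0 \<Rightarrow> \<zero> | Suc j \<Rightarrow> coeff q j) \<ominus> u \<otimes> s \<otimes> coeff q i) \<otimes> s [^] i"
      by (simp only: a_def coeff_linear_mult[OF r(1) q] us)
    also have "\<dots> = c \<otimes> (case i of 0 \<Rightarrow> \<zero> | Suc j \<Rightarrow> coeff q j) \<otimes> s [^] i \<ominus> u \<otimes> b i"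
      unfolding b_def by (rule id) (use s in \<open>auto split: nat.split\<close>)
    also have "c \<otimes> (case i of 0 \<Rightarrow> \<zero> | Suc j \<Rightarrow> coeff q j) \<otimes> s [^] i = b' i"
      using c s by (auto simp: b'_def b_def m_ac split: nat.split)
    finally show ?thesis .
  qed
  have va: "0 \<le> v (a i)" for i using int by (simp add: scaled_integral_def a_def)
  \<comment> \<open>Division starts at the constant term: \<open>b i = (b' i - a i) / u\<close>, where \<open>b' i\<close> is the
    preceding coefficient of the cofactor.\<close>
  have vb_step: "0 \<le> v (b i)" if "0 \<le> v (b' i)" for i
  proof -
    have id: "y = x \<ominus> (x \<ominus> y)" if "x \<in> carrier L" "y \<in> carrier L" for x y
      using that by algebra
    have "u \<otimes> b i = b' i \<ominus> a i" unfolding ab by (rule id) (use u in simp_all)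
    then have "v (u \<otimes> b i) = v (b' i \<ominus> a i)" by simp
    moreover have "0 \<le> v (b' i \<ominus> a i)" by (rule val_diff_nonneg) (use that va in auto)
    ultimately show ?thesis using u by (simp add: val_mult)
  qed
  have vb: "0 \<le> v (b i)" for i
    by (induction i) (auto intro!: vb_step simp: b'_def val_zero)
  then have vb': "0 \<le> v (b' i)" for i
    by (auto simp: b'_def val_zero split: nat.split)
  show int': "scaled_integral (c \<otimes> s) s q"
    using vb by (simp add: scaled_integral_def b_def)
  have c': "c \<otimes> s \<in> carrier L" using c s by simp
  have ru: "residue u \<in> carrier \<kappa>" using u by (simp add: residue_closed)
  have lK: "[\<one>\<^bsub>\<kappa>\<^esub>, \<ominus>\<^bsub>\<kappa>\<^esub> residue u] \<in> carrier (poly_ring \<kappa>)"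
    using ru by (rule K.linear_poly_closed) simp
  have qK: "scaled_reduction (c \<otimes> s) s q \<in> carrier (poly_ring \<kappa>)"
    by (rule scaled_reduction_closed[OF c' s(1) q int'])
  show "?lhs = ?rhs"
  proof (rule K.poly_eqI)
    show "?lhs \<in> carrier (poly_ring \<kappa>)" by (rule scaled_reduction_closed[OF c s(1) f int])
    show "?rhs \<in> carrier (poly_ring \<kappa>)" using lK qK by simp
    fix i
    have "ring.coeff \<kappa> ?rhs i =
        (case i of 0 \<Rightarrow> \<zero>\<^bsub>\<kappa>\<^esub> | Suc j \<Rightarrow> residue (b j)) \<ominus>\<^bsub>\<kappa>\<^esub> residue u \<otimes>\<^bsub>\<kappa>\<^esub> residue (b i)"
      by (simp only: K.coeff_linear_mult[OF ru qK] coeff_scaled_reduction[OF c' s(1)] b_def)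
    also have "(case i of 0 \<Rightarrow> \<zero>\<^bsub>\<kappa>\<^esub> | Suc j \<Rightarrow> residue (b j)) = residue (b' i)"
      by (simp add: b'_def residue_zero split: nat.split)
    also have "residue (b' i) \<ominus>\<^bsub>\<kappa>\<^esub> residue u \<otimes>\<^bsub>\<kappa>\<^esub> residue (b i) = residue (a i)"
      unfolding ab using u vb vb' by (simp add: residue_minus residue_mult val_mult)
    finally show "ring.coeff \<kappa> ?lhs i = ring.coeff \<kappa> ?rhs i"
      by (simp only: coeff_scaled_reduction[OF c s(1)] a_def)
  qed
qed

text \<open>
  The roots of \<open>f\<close> of valuation \<open>v s\<close> are split off one by one, with their multiplicities. Each
  of them splits a non-zero root off the reduction; the constant \<open>c\<close> changes with every step.
\<close>

theorem size_roots_val_le_size_roots_reduction: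
  assumes "f \<in> carrier (poly_ring L)" "c \<in> carrier L" "scaled_integral c s f"
    and "scaled_reduction c s f \<noteq> []" and s: "s \<in> carrier L" "s \<noteq> \<zero>"
  shows "size {#x \<in># roots f. v x = v s#} \<le>
    size {#y \<in># ring.roots \<kappa> (scaled_reduction c s f). y \<noteq> \<zero>\<^bsub>\<kappa>\<^esub>#}"
  using assms(1-4)
proof (induction "size (roots f)" arbitrary: c f)
  case 0
  then show ?case by simp
next
  case (Suc n)
  interpret P: domain "poly_ring L" by (rule univ_poly_is_domain[OF carrier_is_subring])
  interpret K: field \<kappa> by (rule residue_field_is_field)
  interpret PK: domain "poly_ring \<kappa>" by (rule K.univ_poly_is_domain[OF K.carrier_is_subring])
  show ?case
  proof (cases "\<exists>r \<in># roots f. v r = v s")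
    case False
    then have "set_mset {#x \<in># roots f. v x = v s#} = {}" by auto
    then show ?thesis by (simp only: set_mset_eq_empty_iff size_empty)
  next
    case True
    then obtain r where r: "r \<in># roots f" "v r = v s" by blast
    then have root: "is_root f r" using roots_mem_iff_is_root[OF Suc.prems(1)] by simp
    then have rc: "r \<in> carrier L" by (simp add: is_root_def)
    obtain q where q: "q \<in> carrier (poly_ring L)" "f = [\<one>, \<ominus> r] \<otimes>\<^bsub>poly_ring L\<^esub> q"
      using is_root_imp_pdivides[OF Suc.prems(1) root] by (auto simp: pdivides_def factor_def)
    have l: "[\<one>, \<ominus> r] \<in> carrier (poly_ring L)" using rc by (rule linear_poly_closed) simp
    have "q \<noteq> []" using root q(2) P.r_null[OF l] by (auto simp: is_root_def univ_poly_zero)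
    then have rf: "roots f = add_mset r (roots q)"
      using poly_mult_degree_one_monic_imp_same_roots[OF rc q(1)] q(2) by simp
    let ?u = "residue (r \<otimes> inv s)" and ?Q = "scaled_reduction (c \<otimes> s) s q"
    note red = scaled_reduction_linear_mult[OF Suc.prems(2) s rc r(2) q(1) Suc.prems(3)[unfolded q(2)]]
    have c': "c \<otimes> s \<in> carrier L" using Suc.prems(2) s by simp
    have qK: "?Q \<in> carrier (poly_ring \<kappa>)" by (rule scaled_reduction_closed[OF c' s(1) q(1) red(1)])
    have sU: "s \<in> Units L" using s field_Units by simp
    have s': "inv s \<in> carrier L" using sU by simp
    have "v s \<noteq> \<infinity>" "v s \<noteq> -\<infinity>" using s val_eq_PInf_iff val_not_MInf by auto
    then have "v (r \<otimes> inv s) = 0" using r rc s s' by (cases "v s") (auto simp: val_mult val_inverse)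
    then have u: "?u \<in> carrier \<kappa>" "?u \<noteq> \<zero>\<^bsub>\<kappa>\<^esub>"
      using rc s' by (simp_all add: residue_closed residue_eq_zero_iff)
    have lK: "[\<one>\<^bsub>\<kappa>\<^esub>, \<ominus>\<^bsub>\<kappa>\<^esub> ?u] \<in> carrier (poly_ring \<kappa>)" using u(1) by (rule K.linear_poly_closed) simp
    have "?Q \<noteq> []"
      using Suc.prems(4) red(2) PK.r_null[OF lK] by (auto simp: q(2) univ_poly_zero)
    then have rK: "ring.roots \<kappa> (scaled_reduction c s f) = add_mset ?u (ring.roots \<kappa> ?Q)"
      using K.poly_mult_degree_one_monic_imp_same_roots[OF u(1) qK] red(2) q(2) by simp
    have "size {#x \<in># roots q. v x = v s#} \<le> size {#y \<in># ring.roots \<kappa> ?Q. y \<noteq> \<zero>\<^bsub>\<kappa>\<^esub>#}"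
      using Suc.hyps(1)[OF _ q(1) c' red(1) \<open>?Q \<noteq> []\<close>] Suc.hyps(2) rf by simp
    then show ?thesis using u r(2) by (simp add: rf rK)
  qed
qed

end

section \<open>Valuations of the roots\<close>

text \<open>
  The real value of the valuation, which is meant for non-zero arguments; \<open>rval \<zero> = 0\<close> is a
  default.
\<close>

definition (in nonarch_valued_field) rval :: "'a \<Rightarrow> real" where
  "rval x = real_of_ereal (v x)"

text \<open>
  The exponents whose points \<open>(i, v a\<^sub>i)\<close> lie on the supporting line of slope \<open>- m\<close> of the Newton
  polygon of \<open>f\<close>.
\<close>

definition (in nonarch_valued_field) newton_edge :: "'a list \<Rightarrow> real \<Rightarrow> nat set" where
  "newton_edge f m = {i. coeff f i \<noteq> \<zero> \<and>
    (\<forall>j. coeff f j \<noteq> \<zero> \<longrightarrow> rval (coeff f i) + real i * m \<le> rval (coeff f j) + real j * m)}"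

context nonarch_valued_field
begin

lemma val_eq_rval:
  assumes "x \<in> carrier L" "x \<noteq> \<zero>"
  shows "v x = ereal (rval x)"
  using val_eq_PInf_iff[OF assms(1)] val_not_MInf[OF assms(1)] assms(2)
  by (cases "v x") (auto simp: rval_def)

lemma rval_mult:
  assumes "x \<in> carrier L" "x \<noteq> \<zero>" "y \<in> carrier L" "y \<noteq> \<zero>"
  shows "rval (x \<otimes> y) = rval x + rval y"
proof -
  have "v (x \<otimes> y) = ereal (rval x + rval y)"
    by (simp add: val_mult[OF assms(1,3)] val_eq_rval[OF assms(1,2)] val_eq_rval[OF assms(3,4)])
  then show ?thesis by (simp add: rval_def[of "x \<otimes> y"])
qed

lemma pow_nonzero:
  assumes "x \<in> carrier L" "x \<noteq> \<zero>"
  shows "x [^] (n :: nat) \<noteq> \<zero>"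
  using assms by (induction n) (auto simp: integral_iff)

lemma rval_pow:
  assumes "x \<in> carrier L" "x \<noteq> \<zero>"
  shows "rval (x [^] (n :: nat)) = real n * rval x"
proof (induction n)
  case 0
  show ?case by (simp add: rval_def val_one)
next
  case (Suc n)
  then show ?case using assms by (simp add: rval_mult pow_nonzero distrib_right)
qed

text \<open>
  The constant \<open>c\<close> is the inverse of a term \<open>a\<^sub>k s\<^sup>k\<close> of least valuation: then the terms of
  \<open>c f(s x)\<close> that survive the reduction are those of the same least valuation.
\<close>

lemma exists_scaling:
  assumes f: "f \<in> carrier (poly_ring L)" "f \<noteq> []" and s: "s \<in> carrier L" "s \<noteq> \<zero>"
  obtains c where "c \<in> carrier L" "scaled_integral c s f" "scaled_reduction c s f \<noteq> []"
    "{i. ring.coeff \<kappa> (scaled_reduction c s f) i \<noteq> \<zero>\<^bsub>\<kappa>\<^esub>} = newton_edge f (rval s)"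
proof -
  interpret K: field \<kappa> by (rule residue_field_is_field)
  let ?S = "{i. coeff f i \<noteq> \<zero>}"
  define g where "g i = rval (coeff f i) + real i * rval s" for i
  have cf [simp]: "coeff f i \<in> carrier L" for i using poly_coeff_closed[OF f(1)] .
  have S: "finite ?S" "?S \<noteq> {}" using finite_coeff_support poly_nonzero_iff[OF f(1)] f(2) by auto
  then have "Min (g ` ?S) \<in> g ` ?S" by (intro Min_in) auto
  then obtain k where k: "coeff f k \<noteq> \<zero>" "g k = Min (g ` ?S)" by auto
  have min: "g k \<le> g i" if "coeff f i \<noteq> \<zero>" for i
    unfolding k(2) using S that by (intro Min_le) auto
  let ?d = "coeff f k \<otimes> s [^] k"
  have d: "?d \<in> carrier L" "?d \<noteq> \<zero>" using k(1) s by (auto simp: integral_iff pow_nonzero)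
  have dU: "?d \<in> Units L" using d field_Units by simp
  let ?c = "inv ?d"
  have c: "?c \<in> carrier L" using dU by simp
  have vi: "v (?c \<otimes> coeff f i \<otimes> s [^] i) = ereal (g i - g k)" if "coeff f i \<noteq> \<zero>" for i
  proof -
    have "v ?c = ereal (- g k)"
      using val_inverse[OF d] val_eq_rval[OF d] k(1) s by (simp add: rval_mult rval_pow pow_nonzero g_def)
    moreover have "v (coeff f i \<otimes> s [^] i) = ereal (g i)"
      using val_eq_rval[of "coeff f i \<otimes> s [^] i"] that s
      by (simp add: rval_mult rval_pow pow_nonzero g_def integral_iff)
    ultimately show ?thesis using c s by (simp add: m_assoc val_mult)
  qed
  have v0: "v (?c \<otimes> coeff f i \<otimes> s [^] i) = \<infinity>" if "coeff f i = \<zero>" for i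
    using that c s by (simp add: val_zero)
  have int: "scaled_integral ?c s f"
    unfolding scaled_integral_def
  proof
    fix i show "0 \<le> v (?c \<otimes> coeff f i \<otimes> s [^] i)"
      using min vi v0 by (cases "coeff f i = \<zero>") auto
  qed
  have supp: "{i. ring.coeff \<kappa> (scaled_reduction ?c s f) i \<noteq> \<zero>\<^bsub>\<kappa>\<^esub>} = newton_edge f (rval s)"
  proof -
    have "ring.coeff \<kappa> (scaled_reduction ?c s f) i \<noteq> \<zero>\<^bsub>\<kappa>\<^esub> \<longleftrightarrow> \<not> 0 < v (?c \<otimes> coeff f i \<otimes> s [^] i)" for i
      using residue_eq_zero_iff[of "?c \<otimes> coeff f i \<otimes> s [^] i"] int c s
      by (simp add: coeff_scaled_reduction[OF c s(1)] scaled_integral_def)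
    also have "\<dots> i \<longleftrightarrow> coeff f i \<noteq> \<zero> \<and> g i \<le> g k" for i
      using vi v0 by (cases "coeff f i = \<zero>") auto
    finally show ?thesis
      using min k(1) unfolding newton_edge_def g_def[symmetric] by (auto intro: order_trans)
  qed
  have "k \<in> newton_edge f (rval s)"
    using k(1) min by (simp add: newton_edge_def g_def)
  then have "scaled_reduction ?c s f \<noteq> []" using supp by auto
  then show thesis using that c int supp by blast
qed

text \<open>
  With the scaling by the root \<open>s\<close> itself, the reduction has the root \<open>1\<close>, so it has at least
  two terms, and these sit at the exponents of the edge.
\<close>

lemma card_newton_edge_of_root:
  assumes char_0: "inj (\<lambda>n :: nat. [n] \<cdot>\<^bsub>\<kappa>\<^esub> \<one>\<^bsub>\<kappa>\<^esub>)"
    and f: "f \<in> carrier (poly_ring L)" and s: "is_root f s" "s \<noteq> \<zero>"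
  shows "2 \<le> card (newton_edge f (rval s))"
proof -
  interpret K: field \<kappa> by (rule residue_field_is_field)
  interpret PK: domain "poly_ring \<kappa>" by (rule K.univ_poly_is_domain[OF K.carrier_is_subring])
  have sc: "s \<in> carrier L" and f0: "f \<noteq> []" using s(1) by (auto simp: is_root_def)
  obtain c where c: "c \<in> carrier L" "scaled_integral c s f" "scaled_reduction c s f \<noteq> []"
    "{i. ring.coeff \<kappa> (scaled_reduction c s f) i \<noteq> \<zero>\<^bsub>\<kappa>\<^esub>} = newton_edge f (rval s)"
    by (rule exists_scaling[OF f f0 sc s(2)])
  obtain q where q: "q \<in> carrier (poly_ring L)" "f = [\<one>, \<ominus> s] \<otimes>\<^bsub>poly_ring L\<^esub> q"
    using is_root_imp_pdivides[OF f s(1)] by (auto simp: pdivides_def factor_def)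
  have sU: "s \<in> Units L" using sc s(2) field_Units by simp
  note red = scaled_reduction_linear_mult[OF c(1) sc s(2) sc refl q(1) c(2)[unfolded q(2)]]
  have F: "scaled_reduction c s f \<in> carrier (poly_ring \<kappa>)"
    by (rule scaled_reduction_closed[OF c(1) sc f c(2)])
  have "scaled_reduction (c \<otimes> s) s q \<in> carrier (poly_ring \<kappa>)"
    by (rule scaled_reduction_closed[OF _ sc q(1) red(1)]) (use c(1) sc in simp)
  moreover have "[\<one>\<^bsub>\<kappa>\<^esub>, \<ominus>\<^bsub>\<kappa>\<^esub> \<one>\<^bsub>\<kappa>\<^esub>] \<in> carrier (poly_ring \<kappa>)" by (rule K.linear_poly_closed) simp_all
  ultimately have "[\<one>\<^bsub>\<kappa>\<^esub>, \<ominus>\<^bsub>\<kappa>\<^esub> \<one>\<^bsub>\<kappa>\<^esub>] [^]\<^bsub>poly_ring \<kappa>\<^esub> (1 :: nat) pdivides\<^bsub>\<kappa>\<^esub> scaled_reduction c s f"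
    unfolding pdivides_def factor_def
    using red(2)[folded q(2)] sU by (intro bexI) (simp_all add: residue_one)
  then have "1 < num_terms \<kappa> (scaled_reduction c s f)"
    by (rule K.linear_pow_divisor_less_num_terms[OF char_0 K.one_closed K.one_not_zero F c(3)])
  then show ?thesis unfolding num_terms_def c(4) by simp
qed

lemma newton_edgeD:
  assumes "i \<in> newton_edge f m"
  shows "coeff f i \<noteq> \<zero>"
    and "coeff f j \<noteq> \<zero> \<Longrightarrow> rval (coeff f i) + real i * m \<le> rval (coeff f j) + real j * m"
  using CollectD[OF assms[unfolded newton_edge_def], THEN conjunct1]
    CollectD[OF assms[unfolded newton_edge_def], THEN conjunct2, rule_format] .

text \<open>
  The weight \<open>v a\<^sub>l + l m\<close> minus the weight \<open>v a\<^sub>k + k m\<close> grows with \<open>m\<close> as \<open>k < l\<close>. It is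
  zero at \<open>m'\<close> and non-negative at \<open>m\<close>. If both edges have \<open>k\<close> as left end and at least one
  further exponent, symmetry gives \<open>m = m'\<close>.
\<close>

lemma newton_edge_slope_le:
  assumes "k \<in> newton_edge f m" "k \<in> newton_edge f m'" "l \<in> newton_edge f m'" "k < l"
  shows "m' \<le> m"
proof -
  have "rval (coeff f l) + real l * m' \<le> rval (coeff f k) + real k * m'"
    by (rule newton_edgeD(2)[OF assms(3) newton_edgeD(1)[OF assms(1)]])
  moreover have "rval (coeff f k) + real k * m \<le> rval (coeff f l) + real l * m"
    by (rule newton_edgeD(2)[OF assms(1) newton_edgeD(1)[OF assms(3)]])
  ultimately have "(real l - real k) * m' \<le> (real l - real k) * m"
    unfolding left_diff_distrib by linarith
  then show ?thesis using assms(4) by (simp add: mult_le_cancel_left_pos)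
qed

text \<open>
  The map from the valuation of a root to the left end of its edge is injective, and it misses
  the largest exponent of \<open>f\<close>, as every such edge has at least two exponents.
\<close>

lemma card_root_valuations_less_num_terms:
  assumes char_0: "inj (\<lambda>n :: nat. [n] \<cdot>\<^bsub>\<kappa>\<^esub> \<one>\<^bsub>\<kappa>\<^esub>)"
    and f: "f \<in> carrier (poly_ring L)" "f \<noteq> []"
  shows "card (rval ` {x. is_root f x \<and> x \<noteq> \<zero>}) < num_terms L f"
proof -
  let ?S = "{i. coeff f i \<noteq> \<zero>}" and ?V = "rval ` {x. is_root f x \<and> x \<noteq> \<zero>}"
  have S: "finite ?S" "?S \<noteq> {}" using finite_coeff_support poly_nonzero_iff[OF f(1)] f(2) by auto
  have sub: "newton_edge f m \<subseteq> ?S" for m by (auto simp: newton_edge_def)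
  have fin: "finite (newton_edge f m)" for m using finite_subset[OF sub S(1)] .
  have edge: "Min (newton_edge f m) \<in> newton_edge f m \<and>
      (\<exists>l \<in> newton_edge f m. Min (newton_edge f m) < l)" if "m \<in> ?V" for m
  proof -
    have card: "2 \<le> card (newton_edge f m)" using that card_newton_edge_of_root[OF char_0 f(1)] by auto
    then have "newton_edge f m \<noteq> {}" by auto
    then have min: "Min (newton_edge f m) \<in> newton_edge f m" using fin by simp
    have "\<not> newton_edge f m \<subseteq> {Min (newton_edge f m)}"
    proof
      assume "newton_edge f m \<subseteq> {Min (newton_edge f m)}"
      then have "card (newton_edge f m) \<le> 1" using card_mono[of "{Min (newton_edge f m)}"] by simp
      with card show False by simp
    qed
    then obtain l where "l \<in> newton_edge f m" "l \<noteq> Min (newton_edge f m)" by blast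
    then show ?thesis using min Min_le[OF fin[of m], of l] by (auto intro!: bexI[of _ l])
  qed
  have "card ?V \<le> card (?S - {Max ?S})"
  proof (rule card_inj_on_le)
    show "inj_on (\<lambda>m. Min (newton_edge f m)) ?V"
    proof (rule inj_onI)
      fix m m' assume m: "m \<in> ?V" "m' \<in> ?V" and eq: "Min (newton_edge f m) = Min (newton_edge f m')"
      obtain l l' where "l \<in> newton_edge f m" "Min (newton_edge f m) < l"
        "l' \<in> newton_edge f m'" "Min (newton_edge f m) < l'"
        using edge[OF m(1)] edge[OF m(2)] eq by auto
      moreover have "Min (newton_edge f m) \<in> newton_edge f m" "Min (newton_edge f m) \<in> newton_edge f m'"
        using edge[OF m(1)] edge[OF m(2)] eq by simp_all
      ultimately have "m \<le> m'" "m' \<le> m" using newton_edge_slope_le by blast+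
      then show "m = m'" by simp
    qed
    show "(\<lambda>m. Min (newton_edge f m)) ` ?V \<subseteq> ?S - {Max ?S}"
    proof (rule image_subsetI)
      fix m assume "m \<in> ?V"
      from edge[OF this] obtain l where l: "Min (newton_edge f m) \<in> ?S" "l \<in> ?S" "Min (newton_edge f m) < l"
        using sub by blast
      then show "Min (newton_edge f m) \<in> ?S - {Max ?S}" using Max_ge[OF S(1) l(2)] by auto
    qed
  qed (use S in simp)
  also have "\<dots> < card ?S" by (rule card_Diff1_less[OF S(1) Max_in[OF S]])
  finally show ?thesis by (simp add: num_terms_def)
qed

end

section \<open>Comparison of the bounds\<close>

lemma size_eq_sum_size_fibres:
  "size M = (\<Sum>y \<in> f ` set_mset M. size {#x \<in># M. f x = y#})"
proof -
  have "size {#x \<in># M. f x = y#} = (\<Sum>x \<in> {x \<in> set_mset M. f x = y}. count M x)" for y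
    unfolding size_multiset_overloaded_eq by (rule sum.cong) auto
  then show ?thesis
    using sum.image_gen[of "set_mset M" "count M" f] by (simp add: size_multiset_overloaded_eq)
qed

lemma (in field) B_one_le_B_mult: "B_one t R \<le> B_mult t R"
  unfolding B_one_def B_mult_def
proof (rule SUP_mono)
  fix p assume p: "p \<in> fewnomials t R"
  then have pc: "p \<in> carrier (poly_ring R)" by (simp add: fewnomials_def)
  have "{x \<in> carrier R - {\<zero>}. is_root p x} = set_mset {#x \<in># roots p. x \<noteq> \<zero>#}"
    using roots_mem_iff_is_root[OF pc] by (auto simp: is_root_def)
  then have "card {x \<in> carrier R - {\<zero>}. is_root p x} \<le> size {#x \<in># roots p. x \<noteq> \<zero>#}"
    by (metis size_multiset_overloaded_eq card_eq_sum sum_mono count_greater_eq_one_iff)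
  with p show "\<exists>q \<in> fewnomials t R. enat (card {x \<in> carrier R - {\<zero>}. is_root p x}) \<le>
      enat (size {#x \<in># roots q. x \<noteq> \<zero>#})" by auto
qed

lemma (in field) B_mult_le_B_one:
  assumes char_0: "inj (\<lambda>n :: nat. [n] \<cdot> \<one>)"
  shows "B_mult t R \<le> enat t * B_one t R"
  unfolding B_mult_def
proof (rule SUP_least)
  fix p assume p: "p \<in> fewnomials t R"
  then have pc: "p \<in> carrier (poly_ring R)" "p \<noteq> []" "num_terms R p \<le> t + 1"
    by (simp_all add: fewnomials_def univ_poly_zero)
  let ?M = "{#x \<in># roots p. x \<noteq> \<zero>#}" and ?Z = "{x \<in> carrier R - {\<zero>}. is_root p x}"
  have Z: "set_mset ?M = ?Z"
    using roots_mem_iff_is_root[OF pc(1)] by (auto simp: is_root_def)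
  have "size ?M = (\<Sum>x \<in> ?Z. count ?M x)"
    unfolding Z[symmetric] by (rule size_multiset_overloaded_eq)
  also have "\<dots> \<le> (\<Sum>x \<in> ?Z. t)"
  proof (rule sum_mono)
    fix x assume x: "x \<in> ?Z"
    then have "alg_mult p x < num_terms R p" using alg_mult_less_num_terms[OF char_0 _ _ pc(1,2)] by simp
    then show "count ?M x \<le> t" using x pc(3) by (simp add: alg_mult_eq_count_roots[OF pc(1)])
  qed
  finally have "size ?M \<le> t * card ?Z" by (simp add: mult.commute)
  then have "enat (size ?M) \<le> enat t * enat (card ?Z)" by simp
  also have "\<dots> \<le> enat t * B_one t R"
    unfolding B_one_def by (intro mult_left_mono SUP_upper p) simp
  finally show "enat (size ?M) \<le> enat t * B_one t R" .
qed

context nonarch_valued_field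
begin

lemma num_terms_scaled_reduction_le:
  assumes "c \<in> carrier L" "s \<in> carrier L"
  shows "num_terms \<kappa> (scaled_reduction c s f) \<le> num_terms L f"
  unfolding num_terms_def
  by (rule card_mono[OF finite_coeff_support])
    (use assms in \<open>auto simp: coeff_scaled_reduction residue_zero\<close>)

text \<open>
  The roots are grouped by valuation. There are at most \<open>t\<close> groups, and each group is bounded by
  the number of non-zero roots of a reduction with at most \<open>t + 1\<close> terms.
\<close>

theorem B_mult_le_B_mult_residue_field:
  assumes char_0: "inj (\<lambda>n :: nat. [n] \<cdot>\<^bsub>\<kappa>\<^esub> \<one>\<^bsub>\<kappa>\<^esub>)"
  shows "B_mult t L \<le> enat t * B_mult t \<kappa>"
  unfolding B_mult_def[of t L]
proof (rule SUP_least)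
  interpret K: field \<kappa> by (rule residue_field_is_field)
  fix f assume "f \<in> fewnomials t L"
  then have f: "f \<in> carrier (poly_ring L)" "f \<noteq> []" "num_terms L f \<le> t + 1"
    by (simp_all add: fewnomials_def univ_poly_zero)
  let ?M = "{#x \<in># roots f. x \<noteq> \<zero>#}" and ?V = "rval ` {x. is_root f x \<and> x \<noteq> \<zero>}"
  have V: "rval ` set_mset ?M = ?V" using roots_mem_iff_is_root[OF f(1)] by simp
  have fibre: "enat (size {#x \<in># ?M. rval x = m#}) \<le> B_mult t \<kappa>" if "m \<in> ?V" for m
  proof -
    from that obtain s where s: "is_root f s" "s \<noteq> \<zero>" "m = rval s" by auto
    then have sc: "s \<in> carrier L" by (simp add: is_root_def)
    obtain c where c: "c \<in> carrier L" "scaled_integral c s f" "scaled_reduction c s f \<noteq> []"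
      by (rule exists_scaling[OF f(1,2) sc s(2)])
    let ?F = "scaled_reduction c s f"
    have "{#x \<in># ?M. rval x = m#} = {#x \<in># roots f. v x = v s#}"
      unfolding filter_filter_mset
    proof (rule filter_mset_cong[OF refl])
      fix x assume "x \<in># roots f"
      then have "x \<in> carrier L" using roots_mem_iff_is_root[OF f(1)] by (simp add: is_root_def)
      then show "x \<noteq> \<zero> \<and> rval x = m \<longleftrightarrow> v x = v s"
        using val_eq_rval[of x] val_eq_rval[OF sc s(2)] val_zero s(3) by (cases "x = \<zero>") auto
    qed
    then have "size {#x \<in># ?M. rval x = m#} \<le> size {#y \<in># K.roots ?F. y \<noteq> \<zero>\<^bsub>\<kappa>\<^esub>#}"
      using size_roots_val_le_size_roots_reduction[OF f(1) c sc s(2)] by simp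
    moreover have "?F \<in> fewnomials t \<kappa>"
      using scaled_reduction_closed[OF c(1) sc f(1) c(2)] c(3) f(3)
        num_terms_scaled_reduction_le[OF c(1) sc, of f]
      by (simp add: fewnomials_def univ_poly_zero)
    then have "enat (size {#y \<in># K.roots ?F. y \<noteq> \<zero>\<^bsub>\<kappa>\<^esub>#}) \<le> B_mult t \<kappa>"
      unfolding B_mult_def by (rule SUP_upper)
    ultimately show ?thesis by (meson enat_ord_simps(1) order_trans)
  qed
  have "size ?M = (\<Sum>m \<in> ?V. size {#x \<in># ?M. rval x = m#})"
    unfolding V[symmetric] by (rule size_eq_sum_size_fibres)
  then have "enat (size ?M) = (\<Sum>m \<in> ?V. enat (size {#x \<in># ?M. rval x = m#}))"
    by (simp only: of_nat_eq_enat[symmetric] of_nat_sum)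
  also have "\<dots> \<le> of_nat (card ?V) * B_mult t \<kappa>"
    by (rule sum_bounded_above) (rule fibre)
  also have "\<dots> \<le> enat t * B_mult t \<kappa>"
    using card_root_valuations_less_num_terms[OF char_0 f(1,2)] f(3)
    by (intro mult_right_mono) (simp_all add: of_nat_eq_enat)
  finally show "enat (size ?M) \<le> enat t * B_mult t \<kappa>" .
qed

end

theorem theorem1p3:
  fixes L :: "('a, 'b) ring_scheme" and v :: "'a \<Rightarrow> ereal" and t :: nat
  assumes "nonarch_valued_field L v"
    and "\<And>n :: int. n \<noteq> 0 \<Longrightarrow> v ([n] \<cdot>\<^bsub>L\<^esub> \<one>\<^bsub>L\<^esub>) = 0"
    and "t \<ge> 1"
  shows "B_one t L \<le> enat (t\<^sup>2) * B_one t (residue_field L v) \<and>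
    B_mult t L \<le> enat (t\<^sup>2) * B_mult t (residue_field L v)"
proof -
  interpret nonarch_valued_field L v by (rule assms(1))
  interpret K: field \<kappa> by (rule residue_field_is_field)
  have char_0: "inj (\<lambda>n :: nat. [n] \<cdot>\<^bsub>\<kappa>\<^esub> \<one>\<^bsub>\<kappa>\<^esub>)" by (rule inj_residue_nat[OF assms(2)])
  note mult = B_mult_le_B_mult_residue_field[OF char_0, of t]
  have sq: "enat (t\<^sup>2) = enat t * enat t" by (simp add: power2_eq_square)
  have "B_one t L \<le> B_mult t L" by (rule B_one_le_B_mult)
  also note mult
  also have "enat t * B_mult t \<kappa> \<le> enat t * (enat t * B_one t \<kappa>)"
    by (intro mult_left_mono K.B_mult_le_B_one[OF char_0]) simp
  finally have "B_one t L \<le> enat (t\<^sup>2) * B_one t \<kappa>" by (simp only: sq mult.assoc)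
  moreover have "enat t * B_mult t \<kappa> \<le> enat (t\<^sup>2) * B_mult t \<kappa>"
    using assms(3) by (intro mult_right_mono) (simp_all add: power2_eq_square)
  with mult have "B_mult t L \<le> enat (t\<^sup>2) * B_mult t \<kappa>" by (rule order_trans)
  ultimately show ?thesis ..
qed

end
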